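(* Let $\mathcal{K}$ be a commutative unital $\mathbb{C}$-algebra, $A\in\mathcal{K}$ invertible, and let $(\beta,\gamma)$ be the Kauffman bracket switchback pair on the free $\mathcal{K}$-module $V$ with basis $\{x,y\}$ (with $R$-matrix $R=A\,1+A^{-1}(\gamma\beta)$). Let $(\beta_1,\gamma_1)$ be a $2$-cocycle of $(V,\beta,\gamma)$, and write $\beta_1(p\otimes q)=\beta^1_{p,q}$ and $\gamma_1(1)=\sum_{p,q\in\{x,y\}}\gamma_1^{p,q}\,(p\otimes q)$ for $p,q\in\{x,y\}$. Let $a,b\in\mathcal{K}[t]/(t^2)$ be invertible and suppose $a^2+b^2+\delta_0ab=0$, where $\delta_0=(\beta+t\beta_1)(\gamma+t\gamma_1)(1)\in\mathcal{K}[t]/(t^2)$. Then the deformation $$R_t=a\,1+b\,(\gamma+t\gamma_1)(\beta+t\beta_1)$$ is a solution to the Yang--Baxter equation on $V_t/(t^2V_t)$. Moreover, $$\delta_0=(-A^2-A^{-2})+t(iA\beta^1_{x,y}-iA^{-1}\beta^1_{y,x})+t(iA\gamma_1^{x,y}-iA^{-1}\gamma_1^{y,x})$$ $$=(-A^2-A^{-2})+t\,\bigl[\,i(A^2-A^{-2})(A^{-1}\beta^1_{x,y}+A\beta^1_{y,x})\,\bigr].$$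
   Context: The Kauffman bracket pair on $V=\mathcal{K}x\oplus\mathcal{K}y$ is: $\beta(x\otimes x)=\beta(y\otimes y)=0$, $\beta(x\otimes y)=iA$, $\beta(y\otimes x)=-iA^{-1}$, and $\gamma(1)=iA\,(x\otimes y)-iA^{-1}(y\otimes x)$; it satisfies the switchback conditions $(\beta\otimes 1)(1\otimes\gamma)=1$ and $(1\otimes\beta)(\gamma\otimes 1)=1$ on $V$ ($1$ denotes identity maps). A $2$-cocycle is a pair $(\beta_1,\gamma_1)\in\mathrm{Hom}(V^{\otimes 2},\mathcal{K})\oplus\mathrm{Hom}(\mathcal{K},V^{\otimes 2})$ with $$(\beta\otimes 1)(1\otimes\gamma_1)+(\beta_1\otimes 1)(1\otimes\gamma)=0,\qquad (1\otimes\beta)(\gamma_1\otimes 1)+(1\otimes\beta_1)(\gamma\otimes 1)=0.$$ $V_t=V\otimes\mathcal{K}[[t]]$; $V_t/(t^2V_t)$ is regarded as a module over $\mathcal{K}[t]/(t^2)$, and all maps are extended linearly in $t$. The Yang--Baxter equation for $S:W\otimes W\to W\otimes W$ is $(S\otimes 1)(1\otimes S)(S\otimes 1)=(1\otimes S)(S\otimes 1)(1\otimes S)$. *)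

theory Defs
  imports "HOL-Analysis.Analysis" "HOL-Computational_Algebra.Polynomial"
begin

locale complex_algebra = module scaleC
  for scaleC :: "complex \<Rightarrow> 'k::comm_ring_1 \<Rightarrow> 'k" +
  assumes scaleC_mult_left: "scaleC c (x * y) = scaleC c x * y"

quotient_type (overloaded) 'k trunc = "'k::comm_ring_1 poly" / "\<lambda>p q. monom 1 2 dvd p - q"
proof (rule equivpI)
  show "reflp (\<lambda>p q :: 'k poly. monom 1 2 dvd p - q)"
    by (rule reflpI) simp
  show "symp (\<lambda>p q :: 'k poly. monom 1 2 dvd p - q)"
    by (rule sympI) (metis dvd_minus_iff minus_diff_eq)
  show "transp (\<lambda>p q :: 'k poly. monom 1 2 dvd p - q)"
  proof (rule transpI)
    fix p q r :: "'k poly"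
    assume "monom 1 2 dvd p - q" "monom 1 2 dvd q - r"
    then have "monom 1 2 dvd (p - q) + (q - r)" by (rule dvd_add)
    then show "monom 1 2 dvd p - r" by simp
  qed
qed

lemma monom_2_dvd_iff:
  fixes p :: "'k::comm_ring_1 poly"
  shows "monom 1 2 dvd p \<longleftrightarrow> coeff p 0 = 0 \<and> coeff p 1 = 0"
  by (auto simp: monom_1_dvd_iff' less_2_cases_iff)

instantiation trunc :: (comm_ring_1) comm_ring_1
begin

lift_definition zero_trunc :: "'a trunc" is 0 .
lift_definition one_trunc :: "'a trunc" is 1 .
lift_definition plus_trunc :: "'a trunc \<Rightarrow> 'a trunc \<Rightarrow> 'a trunc" is "(+)"
  by (simp add: monom_2_dvd_iff)
lift_definition minus_trunc :: "'a trunc \<Rightarrow> 'a trunc \<Rightarrow> 'a trunc" is "(-)"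
  by (simp add: monom_2_dvd_iff)
lift_definition uminus_trunc :: "'a trunc \<Rightarrow> 'a trunc" is uminus
  by (simp add: monom_2_dvd_iff)
lift_definition times_trunc :: "'a trunc \<Rightarrow> 'a trunc \<Rightarrow> 'a trunc" is "(*)"
  by (simp add: monom_2_dvd_iff coeff_mult)

instance
  by standard (transfer; simp add: algebra_simps monom_2_dvd_iff)+

end

lift_definition tconst :: "'k::comm_ring_1 \<Rightarrow> 'k trunc" is "\<lambda>c. [:c:]" .

lift_definition tvar :: "'k::comm_ring_1 trunc" is "[:0, 1:]" .

lift_definition tcoeff0 :: "'k::comm_ring_1 trunc \<Rightarrow> 'k" is "\<lambda>p. coeff p 0"
  by (simp add: monom_2_dvd_iff)

lift_definition tcoeff1 :: "'k::comm_ring_1 trunc \<Rightarrow> 'k" is "\<lambda>p. coeff p 1"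
  by (simp add: monom_2_dvd_iff)

text \<open>\<open>tcoeff0\<close> and \<open>tcoeff1\<close> are the coordinates of an element in the basis \<open>1, t\<close>.\<close>

lemma trunc_decomp: "z = tconst (tcoeff0 z) + tvar * tconst (tcoeff1 z)"
  by transfer (simp add: monom_2_dvd_iff coeff_pCons)

lemma tvar_tvar: "tvar * tvar = (0 :: 'k::comm_ring_1 trunc)"
  by transfer (simp add: monom_2_dvd_iff)

text \<open>
  The free module on a finite set is \<open>'k ^ 'n\<close>, with basis \<open>axis p 1\<close>. The second and third tensor
  powers of \<open>'k ^ 'n\<close> are \<open>'k ^ ('n \<times> 'n)\<close> and \<open>'k ^ ('n \<times> 'n \<times> 'n)\<close>; the ground ring is
  identified with its own zeroth tensor power, so the unit isomorphisms are suppressed. A map out of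
  the ground ring is determined by its value at 1, and the tensor products of maps below are given by
  linear extension from the basis.
\<close>

definition tens :: "'k::comm_ring_1 ^ 'm \<Rightarrow> 'k ^ 'n \<Rightarrow> 'k ^ ('m \<times> 'n)"  (infixr \<open>\<otimes>\<close> 75)
  where "v \<otimes> w = (\<chi> i. v $ fst i * w $ snd i)"

definition assoc :: "'k ^ (('l::finite \<times> 'm::finite) \<times> 'n::finite) \<Rightarrow> 'k ^ ('l \<times> 'm \<times> 'n)"
  where "assoc u = (\<chi> i. u $ ((fst i, fst (snd i)), snd (snd i)))"

definition lin_ext :: "('m::finite \<Rightarrow> 'k::comm_ring_1 ^ 'n) \<Rightarrow> 'k ^ 'm \<Rightarrow> 'k ^ 'n"
  where "lin_ext f u = (\<Sum>p\<in>UNIV. u $ p *s f p)"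

definition form_tensor_id ::
    "('k::comm_ring_1 ^ ('n \<times> 'n) \<Rightarrow> 'k) \<Rightarrow> 'k ^ ('n \<times> 'n \<times> 'n) \<Rightarrow> 'k ^ 'n::finite"
  where "form_tensor_id \<beta> = lin_ext (\<lambda>(p, q, r). \<beta> (axis p 1 \<otimes> axis q 1) *s axis r 1)"

definition id_tensor_form ::
    "('k::comm_ring_1 ^ ('n \<times> 'n) \<Rightarrow> 'k) \<Rightarrow> 'k ^ ('n \<times> 'n \<times> 'n) \<Rightarrow> 'k ^ 'n::finite"
  where "id_tensor_form \<beta> = lin_ext (\<lambda>(p, q, r). \<beta> (axis q 1 \<otimes> axis r 1) *s axis p 1)"

definition coform_tensor_id ::
    "('k::comm_ring_1 \<Rightarrow> 'k ^ ('n \<times> 'n)) \<Rightarrow> 'k ^ 'n::finite \<Rightarrow> 'k ^ ('n \<times> 'n \<times> 'n)"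
  where "coform_tensor_id \<gamma> = lin_ext (\<lambda>p. assoc (\<gamma> 1 \<otimes> axis p 1))"

definition id_tensor_coform ::
    "('k::comm_ring_1 \<Rightarrow> 'k ^ ('n \<times> 'n)) \<Rightarrow> 'k ^ 'n::finite \<Rightarrow> 'k ^ ('n \<times> 'n \<times> 'n)"
  where "id_tensor_coform \<gamma> = lin_ext (\<lambda>p. axis p 1 \<otimes> \<gamma> 1)"

definition endo_tensor_id ::
    "('k::comm_ring_1 ^ ('n \<times> 'n) \<Rightarrow> 'k ^ ('n \<times> 'n))
      \<Rightarrow> 'k ^ ('n \<times> 'n \<times> 'n) \<Rightarrow> 'k ^ ('n::finite \<times> 'n \<times> 'n)"
  where "endo_tensor_id S = lin_ext (\<lambda>(p, q, r). assoc (S (axis p 1 \<otimes> axis q 1) \<otimes> axis r 1))"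

definition id_tensor_endo ::
    "('k::comm_ring_1 ^ ('n \<times> 'n) \<Rightarrow> 'k ^ ('n \<times> 'n))
      \<Rightarrow> 'k ^ ('n \<times> 'n \<times> 'n) \<Rightarrow> 'k ^ ('n::finite \<times> 'n \<times> 'n)"
  where "id_tensor_endo S = lin_ext (\<lambda>(p, q, r). axis p 1 \<otimes> S (axis q 1 \<otimes> axis r 1))"

definition yang_baxter :: "('k::comm_ring_1 ^ ('n \<times> 'n) \<Rightarrow> 'k ^ ('n::finite \<times> 'n)) \<Rightarrow> bool"
  where "yang_baxter S \<longleftrightarrow>
    module_hom (*s) (*s) S \<and>
    endo_tensor_id S \<circ> id_tensor_endo S \<circ> endo_tensor_id S =
    id_tensor_endo S \<circ> endo_tensor_id S \<circ> id_tensor_endo S"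

definition two_cocycle ::
    "('k::comm_ring_1 ^ ('n \<times> 'n) \<Rightarrow> 'k) \<Rightarrow> ('k \<Rightarrow> 'k ^ ('n \<times> 'n)) \<Rightarrow>
     ('k ^ ('n \<times> 'n) \<Rightarrow> 'k) \<Rightarrow> ('k \<Rightarrow> 'k ^ ('n::finite \<times> 'n)) \<Rightarrow> bool"
  where "two_cocycle \<beta> \<gamma> \<beta>\<^sub>1 \<gamma>\<^sub>1 \<longleftrightarrow>
    module_hom (*s) (*) \<beta>\<^sub>1 \<and> module_hom (*) (*s) \<gamma>\<^sub>1 \<and>
    (\<forall>v. form_tensor_id \<beta> (id_tensor_coform \<gamma>\<^sub>1 v) + form_tensor_id \<beta>\<^sub>1 (id_tensor_coform \<gamma> v) = 0) \<and>
    (\<forall>v. id_tensor_form \<beta> (coform_tensor_id \<gamma>\<^sub>1 v) + id_tensor_form \<beta>\<^sub>1 (coform_tensor_id \<gamma> v) = 0)"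

text \<open>
  For a free module \<open>V = 'k ^ 'n\<close> the quotient \<open>V_t / t^2 V_t\<close> is \<open>'k trunc ^ 'n\<close>; each of its elements
  is \<open>u0 + t u1\<close> with coefficient vectors \<open>u0\<close>, \<open>u1\<close> in \<open>V\<close>.
\<close>

definition vconst :: "'k::comm_ring_1 ^ 'n \<Rightarrow> 'k trunc ^ 'n"
  where "vconst v = (\<chi> p. tconst (v $ p))"

definition vcoeff0 :: "'k::comm_ring_1 trunc ^ 'n \<Rightarrow> 'k ^ 'n"
  where "vcoeff0 u = (\<chi> p. tcoeff0 (u $ p))"

definition vcoeff1 :: "'k::comm_ring_1 trunc ^ 'n \<Rightarrow> 'k ^ 'n"
  where "vcoeff1 u = (\<chi> p. tcoeff1 (u $ p))"

definition ext_form :: "('k::comm_ring_1 ^ 'n \<Rightarrow> 'k) \<Rightarrow> 'k trunc ^ 'n \<Rightarrow> 'k trunc"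
  where "ext_form \<beta> u = tconst (\<beta> (vcoeff0 u)) + tvar * tconst (\<beta> (vcoeff1 u))"

definition ext_coform :: "('k::comm_ring_1 \<Rightarrow> 'k ^ 'n) \<Rightarrow> 'k trunc \<Rightarrow> 'k trunc ^ 'n"
  where "ext_coform \<gamma> c = vconst (\<gamma> (tcoeff0 c)) + tvar *s vconst (\<gamma> (tcoeff1 c))"

definition deformed_form ::
    "('k::comm_ring_1 ^ 'n \<Rightarrow> 'k) \<Rightarrow> ('k ^ 'n \<Rightarrow> 'k) \<Rightarrow> 'k trunc ^ 'n \<Rightarrow> 'k trunc"
  where "deformed_form \<beta> \<beta>\<^sub>1 u = ext_form \<beta> u + tvar * ext_form \<beta>\<^sub>1 u"

definition deformed_coform ::
    "('k::comm_ring_1 \<Rightarrow> 'k ^ 'n) \<Rightarrow> ('k \<Rightarrow> 'k ^ 'n) \<Rightarrow> 'k trunc \<Rightarrow> 'k trunc ^ 'n"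
  where "deformed_coform \<gamma> \<gamma>\<^sub>1 c = ext_coform \<gamma> c + tvar *s ext_coform \<gamma>\<^sub>1 c"

datatype kbasis = Bx | By

instance kbasis :: finite
proof
  have "(UNIV :: kbasis set) = {Bx, By}"
    using kbasis.exhaust by auto
  then show "finite (UNIV :: kbasis set)"
    by (metis finite.emptyI finite.insertI)
qed

text \<open>
  \<open>A'\<close> stands for the inverse of \<open>A\<close>. Bilinearity turns the four values of the form on basis tensors
  into the expression below.
\<close>

definition kauffman_form ::
    "(complex \<Rightarrow> 'k::comm_ring_1 \<Rightarrow> 'k) \<Rightarrow> 'k \<Rightarrow> 'k \<Rightarrow> 'k ^ (kbasis \<times> kbasis) \<Rightarrow> 'k"
  where "kauffman_form scaleC A A' u = u $ (Bx, By) * scaleC \<i> A - u $ (By, Bx) * scaleC \<i> A'"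

definition kauffman_coform ::
    "(complex \<Rightarrow> 'k::comm_ring_1 \<Rightarrow> 'k) \<Rightarrow> 'k \<Rightarrow> 'k \<Rightarrow> 'k \<Rightarrow> 'k ^ (kbasis \<times> kbasis)"
  where "kauffman_coform scaleC A A' c =
    c *s (scaleC \<i> A *s (axis Bx 1 \<otimes> axis By 1) - scaleC \<i> A' *s (axis By 1 \<otimes> axis Bx 1))"

end

theory Submission
  imports Defs
begin

text \<open>
  Write \<open>U\<^sub>1\<close> and \<open>U\<^sub>2\<close> for \<open>\<gamma>\<beta>\<close> acting on the first two and on the last two factors of \<open>V \<otimes> V \<otimes> V\<close>.
  The switchback conditions give the Temperley--Lieb relations \<open>U\<^sub>1 U\<^sub>2 U\<^sub>1 = U\<^sub>1\<close>,
  \<open>U\<^sub>2 U\<^sub>1 U\<^sub>2 = U\<^sub>2\<close> and \<open>U\<^sub>i U\<^sub>i = \<delta> U\<^sub>i\<close> with \<open>\<delta> = \<beta>(\<gamma>(1))\<close>, so the two sides of the Yang--Baxter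
  equation for \<open>a + b \<gamma>\<beta>\<close> differ by \<open>b (a\<^sup>2 + b\<^sup>2 + \<delta> a b) (U\<^sub>1 - U\<^sub>2)\<close>. The cocycle condition says
  exactly that the deformed pair still satisfies the switchback conditions modulo \<open>t\<^sup>2\<close>; it also
  expresses \<open>\<gamma>\<^sub>1\<close> through \<open>\<beta>\<^sub>1\<close>, which gives the second formula for \<open>\<delta>\<^sub>0\<close>.
\<close>

section \<open>Coordinates\<close>

lemma axis_tens_axis:
  "axis p 1 \<otimes> axis q 1 = (axis (p, q) 1 :: 'k::comm_ring_1 ^ ('m::finite \<times> 'n::finite))"
  by (auto simp: tens_def axis_def vec_eq_iff)

lemma tens_nth: "(v \<otimes> w) $ (p, q) = v $ p * w $ q"
  by (simp add: tens_def)

lemma assoc_nth: "assoc u $ (p, q, r) = u $ ((p, q), r)"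
  by (simp add: assoc_def)

lemma sum_UNIV_pair:
  fixes f :: "'a::finite \<times> 'b::finite \<Rightarrow> 'c::comm_monoid_add"
  shows "(\<Sum>x\<in>UNIV. f x) = (\<Sum>p\<in>UNIV. \<Sum>q\<in>UNIV. f (p, q))"
  by (simp add: sum.cartesian_product flip: UNIV_Times_UNIV)

lemma sum_mult_axis:
  fixes f :: "'n::finite \<Rightarrow> 'k::comm_ring_1"
  shows "(\<Sum>s\<in>UNIV. f s * axis s 1 $ r) = f r" "(\<Sum>s\<in>UNIV. f s * axis r 1 $ s) = f r"
  by (simp_all add: axis_def if_distrib cong: if_cong)

lemma sum_axis_mult:
  fixes f :: "'n::finite \<Rightarrow> 'k::comm_ring_1"
  shows "(\<Sum>s\<in>UNIV. axis r 1 $ s * f s) = f r"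
  by (simp add: mult.commute[of "axis r 1 $ _"] sum_mult_axis)

section \<open>Linear maps over a commutative ring and their values on a basis\<close>

lemma module_vec: "module ((*s) :: 'k::comm_ring_1 \<Rightarrow> 'k ^ 'n \<Rightarrow> 'k ^ 'n)"
  by unfold_locales (simp_all add: vec_eq_iff algebra_simps)

lemma module_times: "module ((*) :: 'k::comm_ring_1 \<Rightarrow> 'k \<Rightarrow> 'k)"
  by unfold_locales (simp_all add: algebra_simps)

lemma module_hom_lin_ext: "module_hom (*s) (*s) (lin_ext f)"
  by (simp add: module_hom_iff module_vec lin_ext_def vec_eq_iff sum_distrib_left
      algebra_simps sum.distrib)

lemma linear_form_expand:
  fixes \<beta> :: "'k::comm_ring_1 ^ 'n::finite \<Rightarrow> 'k"
  assumes "module_hom (*s) (*) \<beta>"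
  shows "\<beta> u = (\<Sum>p\<in>UNIV. u $ p * \<beta> (axis p 1))"
proof -
  have "\<beta> u = \<beta> (\<Sum>p\<in>UNIV. u $ p *s axis p 1)"
    by (simp add: basis_expansion)
  then show ?thesis
    by (simp add: module_hom.sum[OF assms] module_hom.scale[OF assms])
qed

lemma linear_coform_eq:
  assumes "module_hom (*) (*s) \<gamma>"
  shows "\<gamma> c = c *s \<gamma> 1"
  using module_hom.scale[OF assms, of c 1] by simp

section \<open>Coordinates of maps tensored with an identity\<close>

lemma form_tensor_id_nth:
  "form_tensor_id \<beta> u $ r = (\<Sum>p\<in>UNIV. \<Sum>q\<in>UNIV. u $ (p, q, r) * \<beta> (axis (p, q) 1))"
  by (simp add: form_tensor_id_def lin_ext_def sum_UNIV_pair axis_tens_axis sum_mult_axis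
      flip: mult.assoc)

lemma id_tensor_form_nth:
  "id_tensor_form \<beta> u $ p = (\<Sum>q\<in>UNIV. \<Sum>r\<in>UNIV. u $ (p, q, r) * \<beta> (axis (q, r) 1))"
  by (simp add: id_tensor_form_def lin_ext_def sum_UNIV_pair axis_tens_axis sum_mult_axis
      flip: mult.assoc sum_distrib_right)

lemma coform_tensor_id_nth: "coform_tensor_id \<gamma> v $ (p, q, r) = \<gamma> 1 $ (p, q) * v $ r"
  by (simp add: coform_tensor_id_def lin_ext_def assoc_nth tens_nth sum_mult_axis flip: mult.assoc)

lemma id_tensor_coform_nth: "id_tensor_coform \<gamma> v $ (p, q, r) = v $ p * \<gamma> 1 $ (q, r)"
  by (simp add: id_tensor_coform_def lin_ext_def tens_nth sum_mult_axis
      flip: mult.assoc sum_distrib_right)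

lemma endo_tensor_id_nth:
  "endo_tensor_id S u $ (i, j, k) =
    (\<Sum>p\<in>UNIV. \<Sum>q\<in>UNIV. u $ (p, q, k) * S (axis (p, q) 1) $ (i, j))"
  by (simp add: endo_tensor_id_def lin_ext_def sum_UNIV_pair axis_tens_axis assoc_nth tens_nth
      sum_mult_axis flip: mult.assoc)

lemma id_tensor_endo_nth:
  "id_tensor_endo S u $ (i, j, k) =
    (\<Sum>q\<in>UNIV. \<Sum>r\<in>UNIV. u $ (i, q, r) * S (axis (q, r) 1) $ (j, k))"
proof -
  have "id_tensor_endo S u $ (i, j, k) =
      (\<Sum>p\<in>UNIV. \<Sum>q\<in>UNIV. \<Sum>r\<in>UNIV. u $ (p, q, r) * S (axis (q, r) 1) $ (j, k) * axis p 1 $ i)"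
    by (simp add: id_tensor_endo_def lin_ext_def sum_UNIV_pair axis_tens_axis tens_nth mult_ac)
  then show ?thesis
    by (simp add: sum_mult_axis flip: sum_distrib_right)
qed

section \<open>Switchback pairs and the Yang--Baxter equation\<close>

text \<open>Linearity is bundled in, so that one predicate serves both the pair over
  \<open>'k\<close> and the deformed pair over \<open>'k trunc\<close>.\<close>

definition switchback ::
    "('k::comm_ring_1 ^ ('n \<times> 'n) \<Rightarrow> 'k) \<Rightarrow> ('k \<Rightarrow> 'k ^ ('n::finite \<times> 'n)) \<Rightarrow> bool"
  where "switchback \<beta> \<gamma> \<longleftrightarrow>
    module_hom (*s) (*) \<beta> \<and> module_hom (*) (*s) \<gamma> \<and>
    (\<forall>v. form_tensor_id \<beta> (id_tensor_coform \<gamma> v) = v) \<and>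
    (\<forall>v. id_tensor_form \<beta> (coform_tensor_id \<gamma> v) = v)"

text \<open>Let B be the matrix of values of \<open>\<beta>\<close> on basis tensors and G the
  coefficient matrix of \<open>\<gamma> 1\<close>. The inner sum is an entry of BG; in the mirrored
  composite that follows it is an entry of GB.\<close>

lemma form_tensor_id_id_tensor_coform_nth:
  "form_tensor_id \<beta> (id_tensor_coform \<gamma> v) $ r =
    (\<Sum>p\<in>UNIV. v $ p * (\<Sum>q\<in>UNIV. \<beta> (axis (p, q) 1) * \<gamma> 1 $ (q, r)))"
  by (simp add: form_tensor_id_nth id_tensor_coform_nth sum_distrib_left mult_ac)

lemma id_tensor_form_coform_tensor_id_nth:
  "id_tensor_form \<beta> (coform_tensor_id \<gamma> v) $ p =
    (\<Sum>r\<in>UNIV. v $ r * (\<Sum>q\<in>UNIV. \<gamma> 1 $ (p, q) * \<beta> (axis (q, r) 1)))"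
  unfolding id_tensor_form_nth coform_tensor_id_nth
  by (subst sum.swap) (simp add: sum_distrib_left mult_ac)

text \<open>In matrix terms this switchback condition is BG = 1, and its mirror image is GB = 1. In
  this form both can be checked entry by entry, for the Kauffman pair and for its
  deformation.\<close>

lemma form_coform_contraction_iff:
  "(\<forall>v. form_tensor_id \<beta> (id_tensor_coform \<gamma> v) = v) \<longleftrightarrow>
    (\<forall>p r. (\<Sum>q\<in>UNIV. \<beta> (axis (p, q) 1) * \<gamma> 1 $ (q, r)) = axis p 1 $ r)" (is "?L \<longleftrightarrow> ?R")
proof
  assume ?L
  then have "form_tensor_id \<beta> (id_tensor_coform \<gamma> (axis p 1)) $ r = axis p 1 $ r" for p r
    by simp
  then show ?R
    by (simp add: form_tensor_id_id_tensor_coform_nth sum_axis_mult)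
qed (simp add: vec_eq_iff form_tensor_id_id_tensor_coform_nth sum_mult_axis)

lemma coform_form_contraction_iff:
  "(\<forall>v. id_tensor_form \<beta> (coform_tensor_id \<gamma> v) = v) \<longleftrightarrow>
    (\<forall>p r. (\<Sum>q\<in>UNIV. \<gamma> 1 $ (p, q) * \<beta> (axis (q, r) 1)) = axis r 1 $ p)" (is "?L \<longleftrightarrow> ?R")
proof
  assume ?L
  then have "id_tensor_form \<beta> (coform_tensor_id \<gamma> (axis r 1)) $ p = axis r 1 $ p" for p r
    by simp
  then show ?R
    by (simp add: id_tensor_form_coform_tensor_id_nth sum_axis_mult)
qed (simp add: vec_eq_iff id_tensor_form_coform_tensor_id_nth sum_mult_axis)

text \<open>The form contracts exactly the two factors that the coform created, so a closed loop
  splits off as a scalar. This is the source of the quadratic Temperley--Lieb relation.\<close>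

lemma form_tensor_id_coform_tensor_id:
  assumes "module_hom (*s) (*) \<beta>"
  shows "form_tensor_id \<beta> (coform_tensor_id \<gamma> v) = \<beta> (\<gamma> 1) *s v"
  by (simp add: vec_eq_iff form_tensor_id_nth coform_tensor_id_nth
      linear_form_expand[OF assms, of "\<gamma> 1"] sum_UNIV_pair sum_distrib_left mult_ac)

lemma id_tensor_form_id_tensor_coform:
  assumes "module_hom (*s) (*) \<beta>"
  shows "id_tensor_form \<beta> (id_tensor_coform \<gamma> v) = \<beta> (\<gamma> 1) *s v"
  by (simp add: vec_eq_iff id_tensor_form_nth id_tensor_coform_nth
      linear_form_expand[OF assms, of "\<gamma> 1"] sum_UNIV_pair sum_distrib_left mult_ac)

text \<open>Linearity of \<open>\<gamma>\<close> moves the scalar \<open>\<beta> _\<close> out of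
  \<open>\<gamma> (\<beta> _)\<close>, so tensoring the composite with the identity factors through
  the ground ring in the first two places.\<close>

lemma endo_tensor_id_skein:
  assumes "module_hom (*) (*s) \<gamma>"
  shows "endo_tensor_id (\<lambda>u. a *s u + b *s \<gamma> (\<beta> u)) u =
    a *s u + b *s coform_tensor_id \<gamma> (form_tensor_id \<beta> u)"
proof -
  have "endo_tensor_id (\<lambda>u. a *s u + b *s \<gamma> (\<beta> u)) u $ (i, j, k) =
      (a *s u + b *s coform_tensor_id \<gamma> (form_tensor_id \<beta> u)) $ (i, j, k)" for i j k
  proof -
    have "(\<Sum>p\<in>UNIV. \<Sum>q\<in>UNIV. u $ (p, q, k) * (a * axis (p, q) 1 $ (i, j))) = a * u $ (i, j, k)"
      \<comment> \<open>The Kronecker delta lives on pairs, so the double sum is evaluated as a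
        single sum over the product index type.\<close>
      using sum_mult_axis(1)[of "\<lambda>x. a * u $ (fst x, snd x, k)" "(i, j)"]
      by (simp add: sum_UNIV_pair mult_ac)
    then show ?thesis
      by (simp add: endo_tensor_id_nth coform_tensor_id_nth form_tensor_id_nth distrib_left
          sum.distrib linear_coform_eq[OF assms, of "\<beta> _"] sum_distrib_left mult_ac)
  qed
  then show ?thesis
    by (simp add: vec_eq_iff)
qed

lemma id_tensor_endo_skein:
  assumes "module_hom (*) (*s) \<gamma>"
  shows "id_tensor_endo (\<lambda>u. a *s u + b *s \<gamma> (\<beta> u)) u =
    a *s u + b *s id_tensor_coform \<gamma> (id_tensor_form \<beta> u)"
proof -
  have "id_tensor_endo (\<lambda>u. a *s u + b *s \<gamma> (\<beta> u)) u $ (i, j, k) =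
      (a *s u + b *s id_tensor_coform \<gamma> (id_tensor_form \<beta> u)) $ (i, j, k)" for i j k
  proof -
    have "(\<Sum>q\<in>UNIV. \<Sum>r\<in>UNIV. u $ (i, q, r) * (a * axis (q, r) 1 $ (j, k))) = a * u $ (i, j, k)"
      using sum_mult_axis(1)[of "\<lambda>x. a * u $ (i, fst x, snd x)" "(j, k)"]
      by (simp add: sum_UNIV_pair mult_ac)
    then show ?thesis
      by (simp add: id_tensor_endo_nth id_tensor_coform_nth id_tensor_form_nth distrib_left
          sum.distrib linear_coform_eq[OF assms, of "\<beta> _"] sum_distrib_left mult_ac)
  qed
  then show ?thesis
    by (simp add: vec_eq_iff)
qed

text \<open>Both triple products contain the mixed words \<open>U\<^sub>1 U\<^sub>2\<close> and
  \<open>U\<^sub>2 U\<^sub>1\<close> with coefficient \<open>a * b\<^sup>2\<close>, so these cancel.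
  What remains are multiples of \<open>U\<^sub>1\<close> and \<open>U\<^sub>2\<close>, after squares
  and cubic words have been reduced.\<close>

lemma temperley_lieb_braid:
  fixes U\<^sub>1 U\<^sub>2 :: "'k::comm_ring_1 ^ 'n \<Rightarrow> 'k ^ 'n"
  assumes lin: "module_hom (*s) (*s) U\<^sub>1" "module_hom (*s) (*s) U\<^sub>2"
    and sq: "\<And>u. U\<^sub>1 (U\<^sub>1 u) = \<delta> *s U\<^sub>1 u" "\<And>u. U\<^sub>2 (U\<^sub>2 u) = \<delta> *s U\<^sub>2 u"
    and tl: "\<And>u. U\<^sub>1 (U\<^sub>2 (U\<^sub>1 u)) = U\<^sub>1 u" "\<And>u. U\<^sub>2 (U\<^sub>1 (U\<^sub>2 u)) = U\<^sub>2 u"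
    and ab: "a\<^sup>2 + b\<^sup>2 + \<delta> * a * b = 0"
  defines "S\<^sub>1 \<equiv> \<lambda>u. a *s u + b *s U\<^sub>1 u" and "S\<^sub>2 \<equiv> \<lambda>u. a *s u + b *s U\<^sub>2 u"
  shows "S\<^sub>1 (S\<^sub>2 (S\<^sub>1 u)) = S\<^sub>2 (S\<^sub>1 (S\<^sub>2 u))"
proof -
  note lin_simps = lin[THEN module_hom.add] lin[THEN module_hom.scale] sq tl
  \<comment> \<open>Passing to a coordinate turns the claim, once the words in the operators are
    reduced, into a polynomial identity in the scalar ring.\<close>
  have "(S\<^sub>1 (S\<^sub>2 (S\<^sub>1 u)) - S\<^sub>2 (S\<^sub>1 (S\<^sub>2 u))) $ i =
      b * (a\<^sup>2 + b\<^sup>2 + \<delta> * a * b) * (U\<^sub>1 u $ i - U\<^sub>2 u $ i)" for i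
    unfolding S\<^sub>1_def S\<^sub>2_def
    by (simp add: lin_simps) (simp add: algebra_simps power2_eq_square)
  then show ?thesis
    by (simp add: ab vec_eq_iff)
qed

lemma yang_baxter_switchback:
  fixes \<beta> :: "'k::comm_ring_1 ^ ('n::finite \<times> 'n) \<Rightarrow> 'k" and \<gamma> :: "'k \<Rightarrow> 'k ^ ('n::finite \<times> 'n)"
  assumes "switchback \<beta> \<gamma>" and ab: "a\<^sup>2 + b\<^sup>2 + \<beta> (\<gamma> 1) * a * b = 0"
  shows "yang_baxter (\<lambda>u. a *s u + b *s \<gamma> (\<beta> u))"
proof -
  have \<beta>: "module_hom (*s) (*) \<beta>" and \<gamma>: "module_hom (*) (*s) \<gamma>"
    and sb: "\<And>v. form_tensor_id \<beta> (id_tensor_coform \<gamma> v) = v"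
      "\<And>v. id_tensor_form \<beta> (coform_tensor_id \<gamma> v) = v"
    using assms(1) by (auto simp: switchback_def)
  have lin: "module_hom (*s) (*s) (form_tensor_id \<beta>)" "module_hom (*s) (*s) (id_tensor_form \<beta>)"
    "module_hom (*s) (*s) (coform_tensor_id \<gamma>)" "module_hom (*s) (*s) (id_tensor_coform \<gamma>)"
    by (simp_all only: form_tensor_id_def id_tensor_form_def coform_tensor_id_def
        id_tensor_coform_def module_hom_lin_ext)
  \<comment> \<open>These rules yield the Temperley--Lieb relations: in
    \<open>U\<^sub>1 U\<^sub>2 U\<^sub>1\<close> the inner maps pair up into two switchback
    composites, each the identity, and in a square the inner pair is a loop whose scalar is pulled
    out by linearity.\<close>
  note simps = lin[THEN module_hom.scale] sb
    form_tensor_id_coform_tensor_id[OF \<beta>] id_tensor_form_id_tensor_coform[OF \<beta>]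
  have U: "module_hom (*s) (*s) (\<lambda>u. coform_tensor_id \<gamma> (form_tensor_id \<beta> u))"
    "module_hom (*s) (*s) (\<lambda>u. id_tensor_coform \<gamma> (id_tensor_form \<beta> u))"
    using module_hom_compose[OF lin(1,3)] module_hom_compose[OF lin(2,4)] by (simp_all add: o_def)
  have "module_hom (*s) (*s) (\<lambda>u. a *s u + b *s \<gamma> (\<beta> u))"
    by (simp add: module_hom_iff module_vec module_hom.add[OF \<beta>] module_hom.add[OF \<gamma>]
        module_hom.scale[OF \<beta>] module_hom.scale[OF \<gamma>] vec_eq_iff algebra_simps)
  then show ?thesis
    unfolding yang_baxter_def fun_eq_iff o_def endo_tensor_id_skein[OF \<gamma>] id_tensor_endo_skein[OF \<gamma>]
    using temperley_lieb_braid[OF U _ _ _ _ ab] by (simp add: simps)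
qed

section \<open>Deformation by a cocycle\<close>

lemma tconst_0: "tconst 0 = 0"
  by transfer simp

lemma tconst_1: "tconst 1 = 1"
  by transfer (simp add: one_pCons)

lemma tconst_add: "tconst (x + y) = tconst x + tconst y"
  by transfer simp

lemma tconst_mult: "tconst (x * y) = tconst x * tconst y"
  by transfer simp

lemma tconst_sum: "tconst (sum f I) = (\<Sum>i\<in>I. tconst (f i))"
  by (induction I rule: infinite_finite_induct) (simp_all add: tconst_0 tconst_add)

text \<open>Recombining the two coefficient vectors by \<open>trunc_decomp\<close> shows that the
  extension is linear over \<open>'k trunc\<close>, with the same matrix entries as before, now read
  as constants.\<close>

lemma ext_form_eq:
  fixes \<beta> :: "'k::comm_ring_1 ^ 'n::finite \<Rightarrow> 'k"
  assumes "module_hom (*s) (*) \<beta>"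
  shows "ext_form \<beta> u = (\<Sum>p\<in>UNIV. u $ p * tconst (\<beta> (axis p 1)))"
proof -
  have "ext_form \<beta> u = (\<Sum>p\<in>UNIV. (tconst (tcoeff0 (u $ p)) + tvar * tconst (tcoeff1 (u $ p)))
      * tconst (\<beta> (axis p 1)))"
    unfolding ext_form_def linear_form_expand[OF assms, of "vcoeff0 u"]
      linear_form_expand[OF assms, of "vcoeff1 u"]
    by (simp add: vcoeff0_def vcoeff1_def tconst_sum tconst_mult sum_distrib_left sum.distrib
        algebra_simps)
  then show ?thesis
    by (simp flip: trunc_decomp)
qed

lemma ext_coform_eq:
  assumes "module_hom (*) (*s) \<gamma>"
  shows "ext_coform \<gamma> c = c *s vconst (\<gamma> 1)"
proof -
  have "ext_coform \<gamma> c = (tconst (tcoeff0 c) + tvar * tconst (tcoeff1 c)) *s vconst (\<gamma> 1)"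
    by (simp add: ext_coform_def linear_coform_eq[OF assms, of "tcoeff0 c"]
        linear_coform_eq[OF assms, of "tcoeff1 c"] vconst_def vec_eq_iff tconst_mult algebra_simps)
  then show ?thesis
    by (simp flip: trunc_decomp)
qed

lemma deformed_form_eq:
  fixes \<beta> :: "'k::comm_ring_1 ^ 'n::finite \<Rightarrow> 'k"
  assumes "module_hom (*s) (*) \<beta>" "module_hom (*s) (*) \<beta>\<^sub>1"
  shows "deformed_form \<beta> \<beta>\<^sub>1 u =
    (\<Sum>p\<in>UNIV. u $ p * (tconst (\<beta> (axis p 1)) + tvar * tconst (\<beta>\<^sub>1 (axis p 1))))"
  by (simp add: deformed_form_def ext_form_eq assms sum_distrib_left sum.distrib algebra_simps)

lemma deformed_coform_eq:
  assumes "module_hom (*) (*s) \<gamma>" "module_hom (*) (*s) \<gamma>\<^sub>1"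
  shows "deformed_coform \<gamma> \<gamma>\<^sub>1 c = c *s (vconst (\<gamma> 1) + tvar *s vconst (\<gamma>\<^sub>1 1))"
  by (simp add: deformed_coform_def ext_coform_eq assms vec_eq_iff algebra_simps)

text \<open>One entry of a product of deformed matrices: the constant term is the undeformed
  contraction, the coefficient of t is the cocycle expression, and the remaining term dies with the
  square of t.\<close>

lemma deformed_contraction:
  fixes f g :: "'i \<Rightarrow> 'k::comm_ring_1"
  assumes "(\<Sum>q\<in>I. f q * g q) = c" "(\<Sum>q\<in>I. f q * g\<^sub>1 q) + (\<Sum>q\<in>I. f\<^sub>1 q * g q) = 0"
  shows "(\<Sum>q\<in>I. (tconst (f q) + tvar * tconst (f\<^sub>1 q)) * (tconst (g q) + tvar * tconst (g\<^sub>1 q))) =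
    tconst c"
proof -
  have "(x + tvar * y) * (z + tvar * w) = x * z + tvar * (x * w + y * z)" for x y z w :: "'k trunc"
  proof -
    have "(x + tvar * y) * (z + tvar * w) = x * z + tvar * (x * w + y * z) + tvar * tvar * (y * w)"
      by (simp add: algebra_simps)
    then show ?thesis by (simp add: tvar_tvar)
  qed
  then show ?thesis
    by (simp add: sum.distrib flip: assms(1) tconst_mult tconst_add tconst_sum sum_distrib_left)
      (simp add: sum.distrib assms(2) tconst_0)
qed

lemma switchback_deformed:
  fixes \<beta> :: "'k::comm_ring_1 ^ ('n::finite \<times> 'n) \<Rightarrow> 'k" and \<gamma> :: "'k \<Rightarrow> 'k ^ ('n::finite \<times> 'n)"
  assumes sb: "switchback \<beta> \<gamma>" and cocycle: "two_cocycle \<beta> \<gamma> \<beta>\<^sub>1 \<gamma>\<^sub>1"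
  shows "switchback (deformed_form \<beta> \<beta>\<^sub>1) (deformed_coform \<gamma> \<gamma>\<^sub>1)"
proof -
  have lin: "module_hom (*s) (*) \<beta>" "module_hom (*s) (*) \<beta>\<^sub>1"
      "module_hom (*) (*s) \<gamma>" "module_hom (*) (*s) \<gamma>\<^sub>1"
    using assms by (auto simp: switchback_def two_cocycle_def)
  have form: "deformed_form \<beta> \<beta>\<^sub>1 (axis p 1) = tconst (\<beta> (axis p 1)) + tvar * tconst (\<beta>\<^sub>1 (axis p 1))"
    for p by (simp add: deformed_form_eq lin sum_axis_mult)
  have coform: "deformed_coform \<gamma> \<gamma>\<^sub>1 1 $ p = tconst (\<gamma> 1 $ p) + tvar * tconst (\<gamma>\<^sub>1 1 $ p)" for p
    by (simp add: deformed_coform_eq lin vconst_def)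
  have tconst_axis: "tconst (axis p 1 $ r) = axis p 1 $ r" for p r :: 'n
    by (simp add: axis_def tconst_0 tconst_1)
  have "form_tensor_id \<beta> (id_tensor_coform \<gamma>\<^sub>1 (axis p 1)) $ r
      + form_tensor_id \<beta>\<^sub>1 (id_tensor_coform \<gamma> (axis p 1)) $ r = 0" for p r
    using cocycle by (simp add: two_cocycle_def flip: vector_add_component)
  then have 1: "(\<Sum>q\<in>UNIV. \<beta> (axis (p, q) 1) * \<gamma>\<^sub>1 1 $ (q, r))
      + (\<Sum>q\<in>UNIV. \<beta>\<^sub>1 (axis (p, q) 1) * \<gamma> 1 $ (q, r)) = 0" for p r
    by (simp add: form_tensor_id_id_tensor_coform_nth sum_axis_mult)
  have "id_tensor_form \<beta> (coform_tensor_id \<gamma>\<^sub>1 (axis r 1)) $ p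
      + id_tensor_form \<beta>\<^sub>1 (coform_tensor_id \<gamma> (axis r 1)) $ p = 0" for p r
    using cocycle by (simp add: two_cocycle_def flip: vector_add_component)
  \<comment> \<open>The summands are swapped relative to the cocycle condition, because here the
    coform supplies the left matrix factor in \<open>deformed_contraction\<close>.\<close>
  then have 2: "(\<Sum>q\<in>UNIV. \<gamma> 1 $ (p, q) * \<beta>\<^sub>1 (axis (q, r) 1))
      + (\<Sum>q\<in>UNIV. \<gamma>\<^sub>1 1 $ (p, q) * \<beta> (axis (q, r) 1)) = 0" for p r
    by (simp add: id_tensor_form_coform_tensor_id_nth sum_axis_mult add.commute)
  have "module_hom (*s) (*) (deformed_form \<beta> \<beta>\<^sub>1)"
    by (simp add: module_hom_iff module_vec module_times deformed_form_eq[OF lin(1,2)] sum_distrib_left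
        sum.distrib distrib_right mult.assoc)
  moreover have "module_hom (*) (*s) (deformed_coform \<gamma> \<gamma>\<^sub>1)"
    by (simp add: module_hom_iff module_vec module_times deformed_coform_eq[OF lin(3,4)]
        vec_eq_iff algebra_simps)
  moreover have "\<forall>v. form_tensor_id (deformed_form \<beta> \<beta>\<^sub>1) (id_tensor_coform (deformed_coform \<gamma> \<gamma>\<^sub>1) v) = v"
    unfolding form_coform_contraction_iff form coform
    using sb deformed_contraction[OF _ 1]
    by (simp add: switchback_def form_coform_contraction_iff tconst_axis)
  moreover have "\<forall>v. id_tensor_form (deformed_form \<beta> \<beta>\<^sub>1) (coform_tensor_id (deformed_coform \<gamma> \<gamma>\<^sub>1) v) = v"
    unfolding coform_form_contraction_iff form coform
    using sb deformed_contraction[OF _ 2]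
    by (simp add: switchback_def coform_form_contraction_iff tconst_axis)
  ultimately show ?thesis
    by (simp add: switchback_def)
qed

text \<open>Expansion in t; the contribution of \<open>\<beta>\<^sub>1 (\<gamma>\<^sub>1 1)\<close>
  carries the square of t and vanishes.\<close>

lemma deformed_form_deformed_coform:
  fixes \<beta> :: "'k::comm_ring_1 ^ 'n::finite \<Rightarrow> 'k"
  assumes "module_hom (*s) (*) \<beta>" "module_hom (*s) (*) \<beta>\<^sub>1"
    "module_hom (*) (*s) \<gamma>" "module_hom (*) (*s) \<gamma>\<^sub>1"
  shows "deformed_form \<beta> \<beta>\<^sub>1 (deformed_coform \<gamma> \<gamma>\<^sub>1 1) =
    tconst (\<beta> (\<gamma> 1)) + tvar * tconst (\<beta>\<^sub>1 (\<gamma> 1)) + tvar * tconst (\<beta> (\<gamma>\<^sub>1 1))"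
proof -
  have t: "tvar * (tvar * x) = 0" for x :: "'k trunc"
    by (simp add: tvar_tvar flip: mult.assoc)
  show ?thesis
    unfolding deformed_form_eq[OF assms(1,2)] deformed_coform_eq[OF assms(3,4)]
      linear_form_expand[OF assms(1), of "\<gamma> 1"] linear_form_expand[OF assms(1), of "\<gamma>\<^sub>1 1"]
      linear_form_expand[OF assms(2), of "\<gamma> 1"]
    by (simp add: vconst_def tconst_sum tconst_mult sum_distrib_left sum.distrib t algebra_simps)
qed

section \<open>The Kauffman bracket\<close>

lemma UNIV_kbasis: "UNIV = {Bx, By}"
  using kbasis.exhaust by auto

lemma all_kbasis: "(\<forall>p. P p) \<longleftrightarrow> P Bx \<and> P By"
  by (metis kbasis.exhaust)

text \<open>Replaces complex scalars by ring elements, so that the imaginary unit takes part in ring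
  normalisation as an element with square -1.\<close>

lemma (in complex_algebra) scaleC_eq_mult: "scaleC c x = scaleC c 1 * x"
  using scaleC_mult_left[of c 1 x] by simp

lemma (in complex_algebra) scaleC_ii_mult_self: "scaleC \<i> 1 * scaleC \<i> 1 = - 1"
proof -
  have "scaleC \<i> 1 * scaleC \<i> 1 = scaleC \<i> (scaleC \<i> 1)"
    by (rule scaleC_eq_mult[symmetric])
  then show ?thesis
    by simp
qed

lemma kauffman_form_axis:
  "kauffman_form scaleC A A' (axis (p, q) 1) =
    (if p = Bx \<and> q = By then scaleC \<i> A else if p = By \<and> q = Bx then - scaleC \<i> A' else 0)"
  by (auto simp: kauffman_form_def axis_def)

lemma kauffman_coform_nth:
  "kauffman_coform scaleC A A' c $ (p, q) = c *
    (if p = Bx \<and> q = By then scaleC \<i> A else if p = By \<and> q = Bx then - scaleC \<i> A' else 0)"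
  by (auto simp: kauffman_coform_def tens_nth axis_def)

text \<open>Form and coform have the same antidiagonal matrix, with entries iA and -iA'. Its square
  is AA' times the identity, so both switchback conditions reduce to
  \<open>A * A' = 1\<close>.\<close>

lemma (in complex_algebra) switchback_kauffman:
  assumes "A * A' = 1"
  shows "switchback (kauffman_form scaleC A A') (kauffman_coform scaleC A A')"
proof -
  let ?J = "scaleC \<i> 1"
  have J: "(?J * A) * (?J * A') = - 1" "(?J * A') * (?J * A) = - 1"
    using assms scaleC_ii_mult_self by (simp_all add: mult_ac)
  show ?thesis
    unfolding switchback_def form_coform_contraction_iff coform_form_contraction_iff
    using J
    by (auto simp: module_hom_iff module_vec module_times all_kbasis UNIV_kbasis vec_eq_iff
        kauffman_form_axis kauffman_coform_nth kauffman_form_def scaleC_eq_mult[of _ A]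
        scaleC_eq_mult[of _ A'] axis_def algebra_simps)
qed

theorem proposition4p2:
  fixes scaleC :: "complex \<Rightarrow> 'k::comm_ring_1 \<Rightarrow> 'k"
    and A A' :: 'k
    and \<beta> \<beta>\<^sub>1 :: "'k ^ (kbasis \<times> kbasis) \<Rightarrow> 'k"
    and \<gamma> \<gamma>\<^sub>1 :: "'k \<Rightarrow> 'k ^ (kbasis \<times> kbasis)"
    and \<beta>c \<gamma>c :: "kbasis \<Rightarrow> kbasis \<Rightarrow> 'k"
    and a b \<delta>\<^sub>0 :: "'k trunc"
    and R\<^sub>t :: "'k trunc ^ (kbasis \<times> kbasis) \<Rightarrow> 'k trunc ^ (kbasis \<times> kbasis)"
  assumes "complex_algebra scaleC"
    and "A * A' = 1"
    and "\<beta> = kauffman_form scaleC A A'"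
    and "\<gamma> = kauffman_coform scaleC A A'"
    and "two_cocycle \<beta> \<gamma> \<beta>\<^sub>1 \<gamma>\<^sub>1"
    and "\<forall>p q. \<beta>\<^sub>1 (axis p 1 \<otimes> axis q 1) = \<beta>c p q"
    and "\<gamma>\<^sub>1 1 = (\<Sum>p\<in>UNIV. \<Sum>q\<in>UNIV. \<gamma>c p q *s (axis p 1 \<otimes> axis q 1))"
    and "\<delta>\<^sub>0 = deformed_form \<beta> \<beta>\<^sub>1 (deformed_coform \<gamma> \<gamma>\<^sub>1 1)"
    and "a dvd 1" and "b dvd 1"
    and "a\<^sup>2 + b\<^sup>2 + \<delta>\<^sub>0 * a * b = 0"
    and "R\<^sub>t = (\<lambda>u. a *s u + b *s deformed_coform \<gamma> \<gamma>\<^sub>1 (deformed_form \<beta> \<beta>\<^sub>1 u))"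
  shows "yang_baxter R\<^sub>t \<and>
    \<delta>\<^sub>0 = tconst (- A\<^sup>2 - A'\<^sup>2)
        + tvar * tconst (scaleC \<i> (A * \<beta>c Bx By) - scaleC \<i> (A' * \<beta>c By Bx))
        + tvar * tconst (scaleC \<i> (A * \<gamma>c Bx By) - scaleC \<i> (A' * \<gamma>c By Bx)) \<and>
    \<delta>\<^sub>0 = tconst (- A\<^sup>2 - A'\<^sup>2)
        + tvar * tconst (scaleC \<i> ((A\<^sup>2 - A'\<^sup>2) * (A' * \<beta>c Bx By + A * \<beta>c By Bx)))"
proof -
  interpret complex_algebra scaleC by fact
  let ?J = "scaleC \<i> 1"
  note [simp] = scaleC_eq_mult[of \<i> A] scaleC_eq_mult[of \<i> A']
  have sb: "switchback \<beta> \<gamma>"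
    using assms by (simp only: switchback_kauffman)
  have lin: "module_hom (*s) (*) \<beta>" "module_hom (*s) (*) \<beta>\<^sub>1"
      "module_hom (*) (*s) \<gamma>" "module_hom (*) (*s) \<gamma>\<^sub>1"
    using sb assms(5) by (auto simp: switchback_def two_cocycle_def)
  have yb: "yang_baxter R\<^sub>t"
    using yang_baxter_switchback[OF switchback_deformed[OF sb assms(5)]] assms by blast
  \<comment> \<open>The trailing factor \<open>z\<close> lets this rule and the next one fire inside
    longer right-nested products.\<close>
  have J: "?J * (?J * z) = - z" for z
    by (simp add: scaleC_ii_mult_self flip: mult.assoc)
  have A: "A * (A' * z) = z" for z
    using assms(2) by (simp flip: mult.assoc)
  have \<gamma>1: "\<gamma>\<^sub>1 1 $ (p, q) = \<gamma>c p q" for p q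
    unfolding assms(7) axis_tens_axis
    using kbasis.exhaust[of p] kbasis.exhaust[of q] by (auto simp: UNIV_kbasis axis_def)
  have \<beta>\<gamma>: "\<beta> (\<gamma> 1) = - A\<^sup>2 - A'\<^sup>2"
    by (simp add: assms(3,4) kauffman_form_def kauffman_coform_nth
        power2_eq_square J scaleC_ii_mult_self mult_ac)
  have \<beta>1\<gamma>: "\<beta>\<^sub>1 (\<gamma> 1) = ?J * (A * \<beta>c Bx By) - ?J * (A' * \<beta>c By Bx)"
    unfolding linear_form_expand[OF lin(2), of "\<gamma> 1"] sum_UNIV_pair
    using assms(6)[unfolded axis_tens_axis]
    by (simp add: UNIV_kbasis assms(4) kauffman_coform_nth mult_ac)
  have \<beta>\<gamma>1: "\<beta> (\<gamma>\<^sub>1 1) = ?J * (A * \<gamma>c Bx By) - ?J * (A' * \<gamma>c By Bx)"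
    by (simp add: assms(3) kauffman_form_def \<gamma>1 mult_ac)
  have \<delta>: "\<delta>\<^sub>0 = tconst (- A\<^sup>2 - A'\<^sup>2) + tvar * tconst (\<beta>\<^sub>1 (\<gamma> 1)) + tvar * tconst (\<beta> (\<gamma>\<^sub>1 1))"
    by (simp only: assms(8) deformed_form_deformed_coform[OF lin] \<beta>\<gamma>)
  have "(form_tensor_id \<beta> (id_tensor_coform \<gamma>\<^sub>1 (axis p 1))
      + form_tensor_id \<beta>\<^sub>1 (id_tensor_coform \<gamma> (axis p 1))) $ r = 0" for p r
    using assms(5) by (simp add: two_cocycle_def)
  then have cocycle: "(\<Sum>q\<in>UNIV. \<beta> (axis (p, q) 1) * \<gamma>\<^sub>1 1 $ (q, r))
      + (\<Sum>q\<in>UNIV. \<beta>\<^sub>1 (axis (p, q) 1) * \<gamma> 1 $ (q, r)) = 0" for p r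
    by (simp add: form_tensor_id_id_tensor_coform_nth sum_axis_mult)
  \<comment> \<open>A diagonal entry of the cocycle condition involves one unknown coefficient of
    \<open>\<gamma>\<^sub>1\<close>, since the Kauffman matrix is antidiagonal. Multiplying by
    \<open>A\<close> then isolates it; the factor \<open>?J\<close> stays, as the coefficient occurs
    with it in \<open>\<delta>\<^sub>0\<close>.\<close>
  have "?J * A' * \<gamma>c Bx By = ?J * A * \<beta>c By Bx"
    using cocycle[of By By] assms(6)[unfolded axis_tens_axis]
    by (simp add: UNIV_kbasis assms(3,4) \<gamma>1 kauffman_form_axis kauffman_coform_nth mult_ac)
  then have "A * (?J * A' * \<gamma>c Bx By) = A * (?J * A * \<beta>c By Bx)"
    by simp
  then have xy: "?J * \<gamma>c Bx By = ?J * (A * (A * \<beta>c By Bx))"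
    by (simp add: A mult_ac)
  have "?J * A * \<gamma>c By Bx = ?J * A' * \<beta>c Bx By"
    using cocycle[of Bx Bx] assms(6)[unfolded axis_tens_axis]
    by (simp add: UNIV_kbasis assms(3,4) \<gamma>1 kauffman_form_axis kauffman_coform_nth mult_ac)
  then have "A' * (?J * A * \<gamma>c By Bx) = A' * (?J * A' * \<beta>c Bx By)"
    by simp
  then have yx: "?J * \<gamma>c By Bx = ?J * (A' * (A' * \<beta>c Bx By))"
    by (simp add: A mult_ac)
  have "\<beta>\<^sub>1 (\<gamma> 1) + \<beta> (\<gamma>\<^sub>1 1) = ?J * (A * \<beta>c Bx By) - ?J * (A' * \<beta>c By Bx)
      + A * (?J * \<gamma>c Bx By) - A' * (?J * \<gamma>c By Bx)"
    by (simp add: \<beta>1\<gamma> \<beta>\<gamma>1 mult_ac)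
  \<comment> \<open>The substituted values contribute the cubes of \<open>A\<close> and
    \<open>A'\<close>; the linear terms match because \<open>A * A' = 1\<close> lowers the mixed
    products on the right.\<close>
  also have "\<dots> = ?J * ((A\<^sup>2 - A'\<^sup>2) * (A' * \<beta>c Bx By + A * \<beta>c By Bx))"
    unfolding xy yx by (simp add: power2_eq_square A algebra_simps)
  finally have "\<beta>\<^sub>1 (\<gamma> 1) + \<beta> (\<gamma>\<^sub>1 1) = \<dots>" .
  then have "tvar * tconst (\<beta>\<^sub>1 (\<gamma> 1)) + tvar * tconst (\<beta> (\<gamma>\<^sub>1 1)) =
      tvar * tconst (?J * ((A\<^sup>2 - A'\<^sup>2) * (A' * \<beta>c Bx By + A * \<beta>c By Bx)))"
    by (simp flip: distrib_left tconst_add)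
  then show ?thesis
    using yb \<delta> \<beta>1\<gamma> \<beta>\<gamma>1
    by (simp add: add.assoc scaleC_eq_mult[of \<i> "_ * _"])
qed

end
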